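(* Let $C$ be an antimonotone $\Pi_t$ circuit ($t\ge 2$) with $n$ variables such that $C$ has no zero-variables and the number of occurrences of the literals in $C$ is $O(n)$. Then $C$ has a satisfying assignment in which at least $f(n) = \log^{(d^{t})}n$ variables are assigned 1, where $\log^{(i)}$ denotes the base-2 logarithm iterated $i$ times, and $d > 0$ is an integer constant (depending only on the constant in the $O(n)$ bound on occurrences).
   Context: A $\Pi_t$ circuit is a Boolean circuit in normalized form of depth at most $t$: the output gate is an AND-gate, every non-variable gate has outdegree at most 1, and starting from the output gate the gates alternate between AND-gates and OR-gates (no NOT-gates; input vertices are literals). Antimonotone means all input literals are negative. A variable $x$ is a zero-variable for $C$ if setting $x=1$ causes $C$ to evaluate to 0. An occurrence of a literal is an edge from that literal to a gate. *)

theory Defs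
  imports Complex_Main
begin

datatype 'x literal = Pos (var_of: 'x) | Neg (var_of: 'x)

primrec lit_true :: "('x \<Rightarrow> bool) \<Rightarrow> 'x literal \<Rightarrow> bool" where
  "lit_true a (Pos x) = a x"
| "lit_true a (Neg x) = (\<not> a x)"

datatype gate_kind = AND | OR

text \<open>The input vertices of a circuit are the literals themselves, so a literal is represented by
  at most one vertex.\<close>

datatype ('x, 'g) vertex = Lit "'x literal" | Gate 'g

record ('x, 'g) circuit =
  verts :: "('x, 'g) vertex set"
  edges :: "(('x, 'g) vertex \<times> ('x, 'g) vertex) set"
  kind :: "'g \<Rightarrow> gate_kind"
  out_gate :: 'g

text \<open>The vertices of indegree 0 are exactly the literals; in particular every gate has at least one
  incoming edge. A literal may have outdegree 0, i.e. a variable need not feed any gate.\<close>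

definition boolean_circuit :: "('x, 'g) circuit \<Rightarrow> bool" where
  "boolean_circuit C \<longleftrightarrow>
     finite (verts C) \<and>
     edges C \<subseteq> verts C \<times> verts C \<and>
     acyclic (edges C) \<and>
     (\<forall>v\<in>verts C. (\<nexists>u. (u, v) \<in> edges C) \<longleftrightarrow> (\<exists>l. v = Lit l)) \<and>
     Gate (out_gate C) \<in> verts C \<and>
     (\<nexists>v. (Gate (out_gate C), v) \<in> edges C)"

text \<open>As there are no NOT-gates, the vertices evaluating to 1 form the least set closed under the
  rules below; acyclicity makes it the unique valuation obeying the gate equations.\<close>

inductive vertex_true :: "('x, 'g) circuit \<Rightarrow> ('x \<Rightarrow> bool) \<Rightarrow> ('x, 'g) vertex \<Rightarrow> bool"
  for C :: "('x, 'g) circuit" and a :: "'x \<Rightarrow> bool" where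
  lit: "lit_true a l \<Longrightarrow> vertex_true C a (Lit l)"
| conj: "kind C g = AND \<Longrightarrow> (\<And>u. (u, Gate g) \<in> edges C \<Longrightarrow> vertex_true C a u)
    \<Longrightarrow> vertex_true C a (Gate g)"
| disj: "kind C g = OR \<Longrightarrow> (u, Gate g) \<in> edges C \<Longrightarrow> vertex_true C a u
    \<Longrightarrow> vertex_true C a (Gate g)"

lemma vertex_true_Lit: "vertex_true C a (Lit l) \<longleftrightarrow> lit_true a l"
  by (auto elim: vertex_true.cases intro: vertex_true.lit)

lemma vertex_true_AND:
  assumes "kind C g = AND"
  shows "vertex_true C a (Gate g) \<longleftrightarrow> (\<forall>u. (u, Gate g) \<in> edges C \<longrightarrow> vertex_true C a u)"
  using assms by (subst vertex_true.simps) auto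

lemma vertex_true_OR:
  assumes "kind C g = OR"
  shows "vertex_true C a (Gate g) \<longleftrightarrow> (\<exists>u. (u, Gate g) \<in> edges C \<and> vertex_true C a u)"
  using assms by (subst vertex_true.simps) auto

definition satisfies :: "('x \<Rightarrow> bool) \<Rightarrow> ('x, 'g) circuit \<Rightarrow> bool" where
  "satisfies a C \<longleftrightarrow> vertex_true C a (Gate (out_gate C))"

definition variables :: "('x, 'g) circuit \<Rightarrow> 'x set" where
  "variables C = {var_of l | l. Lit l \<in> verts C}"

text \<open>Depth is the number of edges on a longest path from an input to the output, so that a
  conjunction of clauses has depth 2.\<close>

definition depth :: "('x, 'g) circuit \<Rightarrow> nat" where
  "depth C = Max {k. \<exists>l. (Lit l, Gate (out_gate C)) \<in> edges C ^^ k}"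

definition Pi_circuit :: "nat \<Rightarrow> ('x, 'g) circuit \<Rightarrow> bool" where
  "Pi_circuit t C \<longleftrightarrow>
     boolean_circuit C \<and>
     depth C \<le> t \<and>
     kind C (out_gate C) = AND \<and>
     (\<forall>g. card {v. (Gate g, v) \<in> edges C} \<le> 1) \<and>
     (\<forall>g h. (Gate g, Gate h) \<in> edges C \<and> (Gate h, Gate (out_gate C)) \<in> (edges C)\<^sup>*
        \<longrightarrow> kind C g \<noteq> kind C h)"

definition antimonotone :: "('x, 'g) circuit \<Rightarrow> bool" where
  "antimonotone C \<longleftrightarrow> (\<forall>l. Lit l \<in> verts C \<longrightarrow> (\<exists>x. l = Neg x))"

definition zero_variable :: "('x, 'g) circuit \<Rightarrow> 'x \<Rightarrow> bool" where
  "zero_variable C x \<longleftrightarrow> x \<in> variables C \<and> (\<forall>a. a x \<longrightarrow> \<not> satisfies a C)"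

definition num_occurrences :: "('x, 'g) circuit \<Rightarrow> nat" where
  "num_occurrences C = card {(l, g). (Lit l, Gate g) \<in> edges C}"

text \<open>Where the iterated logarithm is undefined (some earlier iterate is not positive) it is set
  to 0. Iterating the library logarithm directly would give spurious values there, as it is total on
  the reals.\<close>

definition iter_log2 :: "nat \<Rightarrow> real \<Rightarrow> real" where
  "iter_log2 i = (\<lambda>x. if x > 0 then log 2 x else 0) ^^ i"

end

theory Submission
  imports Defs
begin

text \<open>
  By averaging, at least half of the variables occur at most \<open>K\<close> times, for a suitable constant \<open>K\<close>
  of the order of \<open>2 c\<close>; all others are set to 0. For these variables a power bound holds, by induction
  on the height of a gate: if \<open>X\<close> contains no zero-variable of the gate and \<open>card X \<ge> s ^ e\<close>, then
  some \<open>s\<close> variables in \<open>X\<close> can be set to 1 simultaneously, where \<open>e\<close> depends on \<open>K\<close> and the height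
  only.

  At an OR-gate, \<open>K + 1\<close> of the inputs suffice to give every variable an input that it leaves true, so
  a fraction \<open>1 / (K + 1)\<close> of the variables share such an input. At an AND-gate, either some input
  contains many of the variables, and then a large set satisfying this input is found first, within
  which every variable has fewer occurrences in the remaining inputs; or every input contains few of
  the variables, and then many variables can be chosen such that no two of them share an input.

  The exponent at height \<open>t\<close> is \<open>2 ^ (2 K) ^ t\<close>, which is swamped by the logarithm iterated \<open>d ^ t\<close>
  times as soon as \<open>d\<close> exceeds \<open>2 K\<close> by enough.
\<close>

section \<open>Combinatorics of conjunctions and disjunctions\<close>

text \<open>Pigeonhole by the union bound: fibres may overlap, but \<open>k\<close> of them with at
  most \<open>m - 1\<close> elements each cannot cover \<open>k * m\<close> points.\<close>

lemma exists_large_fibre: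
  fixes m k :: nat
  assumes "finite D" "card D \<le> k" "0 < m" "k * m \<le> card X" "0 < k"
    and cover: "\<And>x. x \<in> X \<Longrightarrow> \<exists>d\<in>D. P x d"
  shows "\<exists>d\<in>D. m \<le> card {x \<in> X. P x d}"
proof (rule ccontr)
  assume "\<not> ?thesis"
  then have small: "card {x \<in> X. P x d} \<le> m - 1" if "d \<in> D" for d
    using that by fastforce
  have "X = (\<Union>d\<in>D. {x \<in> X. P x d})"
    using cover by blast
  then have "card X \<le> (\<Sum>d\<in>D. card {x \<in> X. P x d})"
    by (metis card_UN_le assms(1))
  also have "\<dots> \<le> card D * (m - 1)"
    using small sum_bounded_above[of D "\<lambda>d. card {x \<in> X. P x d}" "m - 1"] by simp
  also have "\<dots> \<le> k * (m - 1)"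
    using assms(2) by simp
  also have "\<dots> < k * m"
    using assms(3,5) by simp
  finally show False
    using assms(4) by simp
qed

text \<open>Each round keeps one \<open>x\<close> and discards its closed neighbourhood; counting
  \<open>x\<close> itself in \<open>B\<close> makes \<open>s * B\<close> points enough for
  \<open>s\<close> rounds.\<close>

lemma greedy_independent_set:
  assumes "finite X" "s * B \<le> card X"
    and sym: "\<And>x y. R x y \<Longrightarrow> R y x"
    and deg: "\<And>x. x \<in> X \<Longrightarrow> card {y \<in> X. y = x \<or> R x y} \<le> B"
    and "0 < B"
  shows "\<exists>Y\<subseteq>X. card Y = s \<and> (\<forall>x\<in>Y. \<forall>y\<in>Y. x \<noteq> y \<longrightarrow> \<not> R x y)"
  using assms(1,2) deg
proof (induction s arbitrary: X)
  case 0
  show ?case by (intro exI[of _ "{}"]) auto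
next
  case (Suc s)
  then have "0 < card X"
    using \<open>0 < B\<close> by (metis add_gr_0 less_le_trans mult_Suc)
  then obtain x where x: "x \<in> X"
    by (metis card_gt_0_iff ex_in_conv)
  define N where "N = {y \<in> X. y = x \<or> R x y}"
  have "card (X - N) = card X - card N"
    by (intro card_Diff_subset) (use Suc.prems(1) in \<open>auto simp: N_def\<close>)
  moreover have "card N \<le> B"
    using Suc.prems(3) x by (simp add: N_def)
  ultimately have large: "s * B \<le> card (X - N)"
    using Suc.prems(2) by simp
  have "card {y \<in> X - N. y = z \<or> R z y} \<le> B" if "z \<in> X - N" for z
  proof -
    have "card {y \<in> X - N. y = z \<or> R z y} \<le> card {y \<in> X. y = z \<or> R z y}"
      using Suc.prems(1) by (intro card_mono) auto
    then show ?thesis using Suc.prems(3)[of z] that by simp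
  qed
  with Suc.IH[of "X - N"] large Suc.prems(1) obtain Y where
    Y: "Y \<subseteq> X - N" "card Y = s" "\<forall>x\<in>Y. \<forall>y\<in>Y. x \<noteq> y \<longrightarrow> \<not> R x y"
    by auto
  have "finite Y" "x \<notin> Y"
    using Y(1) Suc.prems(1) x by (auto simp: N_def intro: finite_subset)
  then have "card (insert x Y) = Suc s"
    using Y(2) by simp
  moreover have "\<not> R x y \<and> \<not> R y x" if "y \<in> Y" for y
    using that Y(1) sym by (auto simp: N_def)
  ultimately show ?case
    using Y x by (intro exI[of _ "insert x Y"]) auto
qed

text \<open>Here \<open>f\<close> is the Boolean function of a subcircuit, applied to the set of variables that are
  assigned 1, and \<open>w x\<close> is the number of occurrences of \<open>x\<close> in it. The condition \<open>f {x}\<close> says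
  that \<open>x\<close> is not a zero-variable of the subcircuit.\<close>

definition large_sat :: "nat \<Rightarrow> nat \<Rightarrow> ('x set \<Rightarrow> bool) \<Rightarrow> ('x \<Rightarrow> nat) \<Rightarrow> bool" where
  "large_sat K e f w \<longleftrightarrow>
     (\<forall>s X. K < s \<and> finite X \<and> (\<forall>x\<in>X. w x \<le> K \<and> f {x}) \<and> s ^ e \<le> card X
        \<longrightarrow> (\<exists>Y\<subseteq>X. s \<le> card Y \<and> f Y))"

lemma large_satD:
  assumes "large_sat K e f w" "K < s" "finite X" "\<And>x. x \<in> X \<Longrightarrow> w x \<le> K"
    "\<And>x. x \<in> X \<Longrightarrow> f {x}" "s ^ e \<le> card X"
  obtains Y where "Y \<subseteq> X" "s \<le> card Y" "f Y"
  using assms unfolding large_sat_def by meson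

lemma large_sat_mono:
  assumes "large_sat K e f w" "e \<le> e'"
  shows "large_sat K e' f w"
  unfolding large_sat_def
proof (intro allI impI, elim conjE)
  fix s and X :: "'a set"
  assume *: "K < s" "finite X" "\<forall>x\<in>X. w x \<le> K \<and> f {x}" "s ^ e' \<le> card X"
  have "s ^ e \<le> s ^ e'"
    using *(1) assms(2) by (intro power_increasing) auto
  then show "\<exists>Y\<subseteq>X. s \<le> card Y \<and> f Y"
    using assms(1) * unfolding large_sat_def by (meson le_trans)
qed

text \<open>Among any \<open>K + 1\<close> disjuncts there is, for each variable, one in which it does not occur; so
  all other disjuncts may be ignored.\<close>

lemma large_sat_disj:
  fixes f :: "'d \<Rightarrow> 'x set \<Rightarrow> bool" and w :: "'d \<Rightarrow> 'x \<Rightarrow> nat"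
  assumes "finite D"
    and local: "\<And>d S T. d \<in> D \<Longrightarrow> (\<And>x. w d x > 0 \<Longrightarrow> x \<in> S \<longleftrightarrow> x \<in> T) \<Longrightarrow> f d S = f d T"
    and empty: "\<And>d. d \<in> D \<Longrightarrow> f d {}"
    and ls: "\<And>d. d \<in> D \<Longrightarrow> large_sat K e (f d) (w d)"
    and sum: "\<And>x. (\<Sum>d\<in>D. w d x) \<le> W x"
  shows "large_sat K (Suc e) (\<lambda>S. \<exists>d\<in>D. f d S) W"
  unfolding large_sat_def
proof (intro allI impI, elim conjE)
  fix s and X :: "'x set"
  assume s: "K < s" and X: "finite X" "\<forall>x\<in>X. W x \<le> K \<and> (\<exists>d\<in>D. f d {x})" "s ^ Suc e \<le> card X"
  have "\<exists>D'\<subseteq>D. card D' \<le> Suc K \<and> (\<forall>x\<in>X. \<exists>d\<in>D'. f d {x})"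
  proof (cases "card D \<le> Suc K")
    case True
    then show ?thesis using X(2) by blast
  next
    case False
    then obtain D' where D': "D' \<subseteq> D" "card D' = Suc K"
      by (meson nat_le_linear obtain_subset_with_card_n)
    have "\<exists>d\<in>D'. f d {x}" if x: "x \<in> X" for x
    proof -
      have "\<exists>d\<in>D'. w d x = 0"
      proof (rule ccontr)
        assume "\<not> ?thesis"
        then have "(\<Sum>d\<in>D'. 1) \<le> (\<Sum>d\<in>D'. w d x)"
          by (intro sum_mono) (auto simp: Suc_le_eq)
        also have "\<dots> \<le> (\<Sum>d\<in>D. w d x)"
          using D' assms(1) by (intro sum_mono2) auto
        also have "\<dots> \<le> K"
          using sum[of x] X(2) x by (meson le_trans)
        finally show False
          using D'(2) by simp
      qed
      then obtain d where d: "d \<in> D'" "w d x = 0" by blast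
      then have "f d {x} = f d {}"
        using D' by (intro local) auto
      then show ?thesis
        using d D' empty by blast
    qed
    with D' show ?thesis
      by (metis order_refl)
  qed
  then obtain D' where D': "D' \<subseteq> D" "card D' \<le> Suc K" "\<forall>x\<in>X. \<exists>d\<in>D'. f d {x}"
    by blast
  \<comment> \<open>As \<open>K < s\<close>, the pigeonhole factor \<open>Suc K\<close> costs just
    one more power of \<open>s\<close>.\<close>
  have "Suc K * s ^ e \<le> s ^ Suc e"
    unfolding power_Suc using s by (intro mult_right_mono) auto
  then have "\<exists>d\<in>D'. s ^ e \<le> card {x \<in> X. f d {x}}"
    using D' X s assms(1)
    by (intro exists_large_fibre[where k = "Suc K"]) (auto intro: finite_subset)
  then obtain d where d: "d \<in> D'" "s ^ e \<le> card {x \<in> X. f d {x}}" by blast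
  have dD: "d \<in> D" using d D' by blast
  have wK: "w d x \<le> K" if "x \<in> X" for x
  proof -
    have "w d x \<le> (\<Sum>d\<in>D. w d x)"
      using dD assms(1) by (intro member_le_sum) auto
    then show ?thesis using sum[of x] X(2) that by (meson le_trans)
  qed
  obtain Y where "Y \<subseteq> {x \<in> X. f d {x}}" "s \<le> card Y" "f d Y"
    by (rule large_satD[OF ls[OF dD] s, of "{x \<in> X. f d {x}}"]) (use wK X(1) d(2) in auto)
  then show "\<exists>Y\<subseteq>X. s \<le> card Y \<and> (\<exists>d\<in>D. f d Y)"
    using dD by blast
qed

text \<open>If some conjunct contains many of the variables, it is satisfied by many of these, and
  restricting to them lowers the number of occurrences in the remaining conjuncts. Otherwise a greedy
  choice yields many variables no two of which share a conjunct.\<close>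

lemma conj_large_sat_aux:
  fixes f :: "'d \<Rightarrow> 'x set \<Rightarrow> bool" and w :: "'d \<Rightarrow> 'x \<Rightarrow> nat"
  assumes "finite D"
    and anti: "\<And>d S T. d \<in> D \<Longrightarrow> S \<subseteq> T \<Longrightarrow> f d T \<Longrightarrow> f d S"
    and local: "\<And>d S T. d \<in> D \<Longrightarrow> (\<And>x. w d x > 0 \<Longrightarrow> x \<in> S \<longleftrightarrow> x \<in> T) \<Longrightarrow> f d S = f d T"
    and empty: "\<And>d. d \<in> D \<Longrightarrow> f d {}"
    and ls: "\<And>d. d \<in> D \<Longrightarrow> large_sat K e (f d) (w d)"
    and "2 \<le> e" "K < s" "j \<le> K" "finite X"
    and "\<And>x. x \<in> X \<Longrightarrow> (\<Sum>d\<in>D. w d x) \<le> j"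
    and "\<And>x d. x \<in> X \<Longrightarrow> d \<in> D \<Longrightarrow> f d {x}"
    and "s ^ ((2 * e) ^ j) \<le> card X"
  shows "\<exists>Y\<subseteq>X. s \<le> card Y \<and> (\<forall>d\<in>D. f d Y)"
  using assms
proof (induction j arbitrary: D X)
  case 0
  have "f d X" if d: "d \<in> D" for d
  proof -
    have "w d x = 0" if "x \<in> X" for x
      using 0(10)[OF that] 0(1) d by simp
    then have "f d X = f d {}"
      using 0(3)[OF d] by (metis empty_iff less_numeral_extra(3))
    then show ?thesis using 0(4)[OF d] by simp
  qed
  then show ?case using 0(12) by (intro exI[of _ X]) auto
next
  case (Suc j D X)
  note fin = Suc.prems(1) and anti = Suc.prems(2) and local = Suc.prems(3)
    and empty = Suc.prems(4) and ls = Suc.prems(5) and occ = Suc.prems(10)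
    and nonzero = Suc.prems(11)
  \<comment> \<open>\<open>r\<close> is what the induction hypothesis needs for the remaining
    conjuncts; \<open>M\<close> is what a single conjunct needs in order to yield \<open>r\<close>
    variables.\<close>
  define r where "r = s ^ ((2 * e) ^ j)"
  define M where "M = r ^ e"
  define T where "T d = {x \<in> X. w d x > 0}" for d
  have s: "0 < s" using \<open>K < s\<close> by simp
  have finT: "finite (T d)" for d using \<open>finite X\<close> by (simp add: T_def)
  have "s ^ 1 \<le> r"
    unfolding r_def using s \<open>2 \<le> e\<close> by (intro power_increasing) auto
  then have r: "K < r" using \<open>K < s\<close> by simp
  have w_le: "w d x \<le> Suc j" if "d \<in> D" "x \<in> X" for d x
  proof -
    have "w d x \<le> (\<Sum>d\<in>D. w d x)"
      using that fin by (intro member_le_sum) auto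
    then show ?thesis using occ[OF that(2)] by simp
  qed
  show ?case
  proof (cases "\<exists>d\<in>D. M \<le> card (T d)")
    case True
    then obtain d where d: "d \<in> D" "M \<le> card (T d)" by blast
    obtain Y where Y: "Y \<subseteq> T d" "r \<le> card Y" "f d Y"
    proof (rule large_satD[OF ls[OF d(1)] r finT[of d]])
      show "w d x \<le> K" if "x \<in> T d" for x
        using that w_le[OF d(1), of x] \<open>Suc j \<le> K\<close> by (simp add: T_def)
      show "f d {x}" if "x \<in> T d" for x
        using that nonzero d(1) by (simp add: T_def)
      show "r ^ e \<le> card (T d)"
        using d(2) by (simp add: M_def)
    qed
    have "\<exists>Z\<subseteq>Y. s \<le> card Z \<and> (\<forall>d\<in>D - {d}. f d Z)"
    proof (rule Suc.IH)
      show "finite (D - {d})" using fin by simp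
      show "\<And>d' S T. d' \<in> D - {d} \<Longrightarrow> S \<subseteq> T \<Longrightarrow> f d' T \<Longrightarrow> f d' S"
        using anti by blast
      show "\<And>d' S T. d' \<in> D - {d} \<Longrightarrow> (\<And>x. w d' x > 0 \<Longrightarrow> x \<in> S \<longleftrightarrow> x \<in> T) \<Longrightarrow> f d' S = f d' T"
        using local by (metis DiffD1)
      show "\<And>d'. d' \<in> D - {d} \<Longrightarrow> f d' {}"
        using empty by blast
      show "\<And>d'. d' \<in> D - {d} \<Longrightarrow> large_sat K e (f d') (w d')"
        using ls by blast
      show "2 \<le> e" "K < s" "j \<le> K"
        using \<open>2 \<le> e\<close> \<open>K < s\<close> \<open>Suc j \<le> K\<close> by auto
      show "finite Y"
        using Y(1) finT by (rule finite_subset)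
      show "(\<Sum>d\<in>D - {d}. w d x) \<le> j" if "x \<in> Y" for x
      proof -
        have x: "x \<in> X" "w d x > 0" using that Y(1) by (auto simp: T_def)
        have "(\<Sum>d\<in>D. w d x) = w d x + (\<Sum>d\<in>D - {d}. w d x)"
          using fin d(1) by (rule sum.remove)
        then show ?thesis using occ[OF x(1)] x(2) by linarith
      qed
      show "\<And>x d'. x \<in> Y \<Longrightarrow> d' \<in> D - {d} \<Longrightarrow> f d' {x}"
        using nonzero Y(1) by (auto simp: T_def)
      show "s ^ ((2 * e) ^ j) \<le> card Y"
        using Y(2) by (simp add: r_def)
    qed
    then obtain Z where Z: "Z \<subseteq> Y" "s \<le> card Z" "\<forall>d\<in>D - {d}. f d Z"
      by blast
    moreover have "f d Z"
      using anti[OF d(1) Z(1) Y(3)] .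
    ultimately show ?thesis
      using Y(1) by (intro exI[of _ Z]) (auto simp: T_def)
  next
    case False
    define R where "R x y \<longleftrightarrow> (\<exists>d\<in>D. w d x > 0 \<and> w d y > 0)" for x y
    have "0 < M" using r by (simp add: M_def)
    have K: "0 < K" using \<open>Suc j \<le> K\<close> by simp
    have "\<exists>Y\<subseteq>X. card Y = s \<and> (\<forall>x\<in>Y. \<forall>y\<in>Y. x \<noteq> y \<longrightarrow> \<not> R x y)"
    proof (rule greedy_independent_set)
      show "finite X" by fact
      show "\<And>x y. R x y \<Longrightarrow> R y x" by (auto simp: R_def)
      show "0 < K * M" using \<open>0 < M\<close> K by simp
      \<comment> \<open>The factor 2 in the base \<open>2 * e\<close> doubles
        \<open>e * (2 * e) ^ j\<close>; the spare copy pays for the two factors \<open>s\<close>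
        that bound \<open>s * K\<close>.\<close>
      have "2 \<le> e * (2 * e) ^ j"
        using \<open>2 \<le> e\<close> mult_le_mono[of 2 e 1 "(2 * e) ^ j"] by auto
      then have exp: "2 + (2 * e) ^ j * e \<le> (2 * e) ^ Suc j"
        by (simp add: algebra_simps)
      have "s * (K * M) \<le> s * (s * M)"
        using \<open>K < s\<close> by simp
      also have "\<dots> = s ^ (2 + (2 * e) ^ j * e)"
        by (simp only: M_def r_def power_add power_mult power2_eq_square mult.assoc)
      also have "\<dots> \<le> s ^ ((2 * e) ^ Suc j)"
        using exp s by (intro power_increasing) auto
      also have "\<dots> \<le> card X" by fact
      finally show "s * (K * M) \<le> card X" .
      show "card {y \<in> X. y = x \<or> R x y} \<le> K * M" if x: "x \<in> X" for x
      proof -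
        define A where "A = {d \<in> D. w d x > 0}"
        have finA: "finite A" using fin by (simp add: A_def)
        show ?thesis
        proof (cases "A = {}")
          \<comment> \<open>A variable without occurrences is not in the union of the sets
            \<open>T d\<close> used below, though it belongs to its own neighbourhood.\<close>
          case True
          then have "{y \<in> X. y = x \<or> R x y} = {x}"
            using x by (auto simp: A_def R_def)
          then show ?thesis using \<open>0 < M\<close> K by (simp add: Suc_le_eq)
        next
          case False
          have "card A = (\<Sum>d\<in>A. 1)" by simp
          also have "\<dots> \<le> (\<Sum>d\<in>A. w d x)"
            by (intro sum_mono) (auto simp: A_def)
          also have "\<dots> \<le> (\<Sum>d\<in>D. w d x)"
            using fin by (intro sum_mono2) (auto simp: A_def)
          also have "\<dots> \<le> K"
            using occ[OF x] \<open>Suc j \<le> K\<close> by simp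
          finally have cardA: "card A \<le> K" .
          have "{y \<in> X. y = x \<or> R x y} \<subseteq> (\<Union>d\<in>A. T d)"
            using False x by (auto simp: A_def R_def T_def)
          then have "card {y \<in> X. y = x \<or> R x y} \<le> card (\<Union>d\<in>A. T d)"
            using finA finT by (intro card_mono) auto
          also have "\<dots> \<le> (\<Sum>d\<in>A. card (T d))"
            using finA by (rule card_UN_le)
          also have "\<dots> \<le> card A * M"
            using \<open>\<not> (\<exists>d\<in>D. M \<le> card (T d))\<close> sum_bounded_above[of A "\<lambda>d. card (T d)" M]
            by (fastforce simp: A_def)
          also have "\<dots> \<le> K * M" using cardA by simp
          finally show ?thesis .
        qed
      qed
    qed
    then obtain Y where Y: "Y \<subseteq> X" "card Y = s" "\<forall>x\<in>Y. \<forall>y\<in>Y. x \<noteq> y \<longrightarrow> \<not> R x y"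
      by blast
    \<comment> \<open>At most one variable of \<open>Y\<close> occurs in \<open>d\<close>, so
      \<open>f d\<close> sees only a singleton or the empty set.\<close>
    have "f d Y" if d: "d \<in> D" for d
    proof (cases "\<exists>x\<in>Y. w d x > 0")
      case True
      then obtain x where x: "x \<in> Y" "w d x > 0" by blast
      then have "f d Y = f d {x}"
        using Y(3) d by (intro local) (auto simp: R_def, metis less_irrefl)
      then show ?thesis using nonzero x Y(1) d by blast
    next
      case False
      then have "f d Y = f d {}"
        using d by (intro local) auto
      then show ?thesis using empty d by blast
    qed
    then show ?thesis using Y by auto
  qed
qed

text \<open>The preceding induction, started at \<open>j = K\<close>.\<close>

lemma large_sat_conj:
  fixes f :: "'d \<Rightarrow> 'x set \<Rightarrow> bool" and w :: "'d \<Rightarrow> 'x \<Rightarrow> nat"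
  assumes "finite D"
    and "\<And>d S T. d \<in> D \<Longrightarrow> S \<subseteq> T \<Longrightarrow> f d T \<Longrightarrow> f d S"
    and "\<And>d S T. d \<in> D \<Longrightarrow> (\<And>x. w d x > 0 \<Longrightarrow> x \<in> S \<longleftrightarrow> x \<in> T) \<Longrightarrow> f d S = f d T"
    and "\<And>d. d \<in> D \<Longrightarrow> f d {}"
    and "\<And>d. d \<in> D \<Longrightarrow> large_sat K e (f d) (w d)"
    and "2 \<le> e"
    and sum: "\<And>x. (\<Sum>d\<in>D. w d x) \<le> W x"
  shows "large_sat K ((2 * e) ^ K) (\<lambda>S. \<forall>d\<in>D. f d S) W"
  unfolding large_sat_def
proof (intro allI impI, elim conjE)
  fix s and X :: "'x set"
  assume s: "K < s" and X: "finite X" "\<forall>x\<in>X. W x \<le> K \<and> (\<forall>d\<in>D. f d {x})"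
    "s ^ (2 * e) ^ K \<le> card X"
  show "\<exists>Y\<subseteq>X. s \<le> card Y \<and> (\<forall>d\<in>D. f d Y)"
  proof (rule conj_large_sat_aux[OF assms(1-6) s order_refl X(1)])
    show "(\<Sum>d\<in>D. w d x) \<le> K" if "x \<in> X" for x
      using sum[of x] X(2) that by (meson le_trans)
  qed (use X in auto)
qed

section \<open>Antimonotone circuits\<close>

text \<open>Paths in \<open>gate_edges\<close> start at a gate, so each vertex has at most one successor along them
  when gates have outdegree at most 1. Edges leaving literals are excluded because literals may have
  large outdegree.\<close>

definition gate_edges :: "('x, 'g) circuit \<Rightarrow> (('x, 'g) vertex \<times> ('x, 'g) vertex) set" where
  "gate_edges C = {(u, v) \<in> edges C. \<exists>g. u = Gate g}"

definition occurrences :: "('x, 'g) circuit \<Rightarrow> ('x, 'g) vertex \<Rightarrow> 'x \<Rightarrow> 'g set" where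
  "occurrences C v x =
     {g. (Lit (Neg x), Gate g) \<in> edges C \<and> (Gate g, v) \<in> (gate_edges C)\<^sup>*}"

text \<open>The second summand lets a literal vertex count as one occurrence of its variable, so that the
  occurrences below a gate are the sum of those below its children.\<close>

definition weight :: "('x, 'g) circuit \<Rightarrow> ('x, 'g) vertex \<Rightarrow> 'x \<Rightarrow> nat" where
  "weight C v x = card (occurrences C v x) + of_bool (v = Lit (Neg x))"

abbreviation val :: "('x, 'g) circuit \<Rightarrow> ('x, 'g) vertex \<Rightarrow> 'x set \<Rightarrow> bool" where
  "val C v S \<equiv> vertex_true C (\<lambda>x. x \<in> S) v"

locale antimonotone_circuit =
  fixes C :: "('x, 'g) circuit"
  assumes circuit: "boolean_circuit C"
    and outdeg: "\<And>g. card {v. (Gate g, v) \<in> edges C} \<le> 1"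
    and anti: "antimonotone C"
begin

section \<open>Edges and valuation\<close>

lemma finite_edges: "finite (edges C)"
  using circuit unfolding boolean_circuit_def by (meson finite_SigmaI finite_subset)

lemma wf_edges: "wf (edges C)"
  using circuit finite_edges finite_acyclic_wf unfolding boolean_circuit_def by blast

lemma edge_verts: "(u, v) \<in> edges C \<Longrightarrow> u \<in> verts C"
  using circuit unfolding boolean_circuit_def by blast

lemma no_edge_to_Lit: "(u, Lit l) \<notin> edges C"
  using circuit unfolding boolean_circuit_def by blast

lemma gate_has_input: "Gate g \<in> verts C \<Longrightarrow> \<exists>u. (u, Gate g) \<in> edges C"
  using circuit unfolding boolean_circuit_def by blast

lemma finite_inputs: "finite {u. (u, v) \<in> edges C}"
  by (rule finite_subset[OF _ finite_imageI[OF finite_edges, of fst]]) force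

lemma vertex_cases [consumes 1, case_names Lit AND OR]:
  assumes "v \<in> verts C"
  obtains x where "v = Lit (Neg x)" | g where "v = Gate g" "kind C g = AND"
    | g where "v = Gate g" "kind C g = OR"
proof (cases v)
  case (Lit l)
  then show ?thesis using assms anti that(1) unfolding antimonotone_def by blast
next
  case (Gate g)
  then show ?thesis using that(2,3) by (cases "kind C g") auto
qed

text \<open>Literals are negative and gates are monotone in their inputs.\<close>

lemma val_antitone:
  assumes "v \<in> verts C" "S \<subseteq> T" "val C v T"
  shows "val C v S"
  using wf_edges assms(1,3)
proof (induction v rule: wf_induct_rule)
  case (less v)
  from less.prems(1) show ?case
  proof (cases rule: vertex_cases)
    case Lit
    then show ?thesis using less.prems(2) assms(2) by (auto simp: vertex_true_Lit)
  next
    case AND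
    then show ?thesis using less.prems(2) less.IH edge_verts by (auto simp: vertex_true_AND)
  next
    case OR
    then show ?thesis using less.prems(2) less.IH edge_verts
      by (auto simp: vertex_true_OR)
  qed
qed

lemma val_empty:
  assumes "v \<in> verts C"
  shows "val C v {}"
  using wf_edges assms
proof (induction v rule: wf_induct_rule)
  case (less v)
  from less.prems show ?case
  proof (cases rule: vertex_cases)
    case Lit
    then show ?thesis by (auto simp: vertex_true_Lit)
  next
    case AND
    then show ?thesis using less.IH edge_verts by (auto simp: vertex_true_AND)
  next
    case (OR g)
    \<comment> \<open>An OR-gate without inputs would evaluate to 0.\<close>
    then obtain u where "(u, Gate g) \<in> edges C"
      using less.prems gate_has_input by blast
    then show ?thesis using OR less.IH edge_verts by (auto simp: vertex_true_OR)
  qed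
qed

section \<open>Counting occurrences below a vertex\<close>

lemma finite_occurrences: "finite (occurrences C v x)"
  by (rule finite_subset[OF _ finite_imageI[OF finite_edges, of "\<lambda>e. case snd e of Gate g \<Rightarrow> g"]])
    (force simp: occurrences_def)

lemma single_valued_gate_edges: "single_valued (gate_edges C)"
proof (rule single_valuedI)
  fix u v v'
  assume "(u, v) \<in> gate_edges C" "(u, v') \<in> gate_edges C"
  then obtain g where g: "u = Gate g" "(Gate g, v) \<in> edges C" "(Gate g, v') \<in> edges C"
    by (auto simp: gate_edges_def)
  have "finite {v. (Gate g, v) \<in> edges C}"
    by (rule finite_subset[OF _ finite_imageI[OF finite_edges, of snd]]) force
  with g outdeg[of g] show "v = v'"
    by (auto simp: card_le_Suc0_iff_eq)
qed

lemma gate_edges_acyclic: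
  assumes "(v, u) \<in> (gate_edges C)\<^sup>*" "(u, v) \<in> edges C"
  shows False
proof -
  have "(v, u) \<in> (edges C)\<^sup>*"
    using assms(1) rtrancl_mono[of "gate_edges C" "edges C"] by (auto simp: gate_edges_def)
  then have "(v, v) \<in> (edges C)\<^sup>+"
    using assms(2) by (rule rtrancl_into_trancl1)
  then show False
    using wf_edges by (meson acyclic_def wf_acyclic)
qed

text \<open>A nontrivial path out of the gate \<open>u\<close> must take its only edge, to
  \<open>v\<close>; going on from \<open>v\<close> to \<open>u'\<close> and back along the edge to
  \<open>v\<close> would close a cycle.\<close>

lemma inputs_incomparable:
  assumes "(u, v) \<in> edges C" "(u', v) \<in> edges C" "(u, u') \<in> (gate_edges C)\<^sup>*"
  shows "u = u'"
proof (rule ccontr)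
  assume "u \<noteq> u'"
  then obtain z where z: "(u, z) \<in> gate_edges C" "(z, u') \<in> (gate_edges C)\<^sup>*"
    using assms(3) by (meson converse_rtranclE)
  then have "(u, v) \<in> gate_edges C"
    using assms(1) by (auto simp: gate_edges_def)
  then have "z = v"
    using z(1) single_valued_gate_edges by (meson single_valuedD)
  then show False
    using z(2) assms(2) gate_edges_acyclic by blast
qed

text \<open>Paths out of a gate do not branch, so if one gate reaches both inputs, one of them
  reaches the other.\<close>

lemma occurrences_disjoint:
  assumes "(u, v) \<in> edges C" "(u', v) \<in> edges C" "u \<noteq> u'"
  shows "occurrences C u x \<inter> occurrences C u' x = {}"
proof (rule ccontr)
  assume "\<not> ?thesis"
  then obtain g where "(Gate g, u) \<in> (gate_edges C)\<^sup>*" "(Gate g, u') \<in> (gate_edges C)\<^sup>*"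
    by (auto simp: occurrences_def)
  then have "(u, u') \<in> (gate_edges C)\<^sup>* \<or> (u', u) \<in> (gate_edges C)\<^sup>*"
    using single_valued_confluent[OF single_valued_gate_edges] by blast
  then show False
    using inputs_incomparable assms by metis
qed

lemma sum_weight_le: "(\<Sum>u\<in>{u. (u, Gate g) \<in> edges C}. weight C u x) \<le> weight C (Gate g) x"
proof -
  define D where "D = {u. (u, Gate g) \<in> edges C}"
  \<comment> \<open>The \<open>of_bool\<close> summand of a literal input is traded for the
    occurrence at \<open>g\<close> itself; by acyclicity \<open>g\<close> lies below none of its
    inputs.\<close>
  define L where "L = {h. h = g \<and> (Lit (Neg x), Gate g) \<in> edges C}"
  have finD: "finite D" by (simp add: D_def finite_inputs)
  have finL: "finite L" by (simp add: L_def)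
  have "(\<Sum>u\<in>D. of_bool (u = Lit (Neg x)) :: nat) = card (D \<inter> {u. u = Lit (Neg x)})"
    using finD by (simp add: of_bool_def sum.If_cases)
  also have "D \<inter> {u. u = Lit (Neg x)} = (if Lit (Neg x) \<in> D then {Lit (Neg x)} else {})"
    by auto
  finally have lits: "(\<Sum>u\<in>D. of_bool (u = Lit (Neg x)) :: nat) = card L"
    by (simp add: L_def D_def)
  have gates: "(\<Sum>u\<in>D. card (occurrences C u x)) = card (\<Union>u\<in>D. occurrences C u x)"
    using finD finite_occurrences occurrences_disjoint
    by (intro card_UN_disjoint[symmetric]) (auto simp: D_def)
  have "g \<notin> (\<Union>u\<in>D. occurrences C u x)"
    using gate_edges_acyclic by (auto simp: D_def occurrences_def)
  then have "(\<Union>u\<in>D. occurrences C u x) \<inter> L = {}"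
    by (auto simp: L_def)
  then have "(\<Sum>u\<in>D. weight C u x) = card ((\<Union>u\<in>D. occurrences C u x) \<union> L)"
    using lits gates finD finL finite_occurrences
    by (simp add: weight_def sum.distrib card_Un_disjoint)
  also have "\<dots> \<le> card (occurrences C (Gate g) x)"
  proof (intro card_mono finite_occurrences subsetI)
    fix h
    assume h: "h \<in> (\<Union>u\<in>D. occurrences C u x) \<union> L"
    show "h \<in> occurrences C (Gate g) x"
    proof (cases "h \<in> L")
      case True
      then show ?thesis by (auto simp: L_def occurrences_def)
    next
      case False
      then obtain u where u: "(u, Gate g) \<in> edges C" "h \<in> occurrences C u x"
        using h by (auto simp: D_def)
      \<comment> \<open>Only edges out of gates count as \<open>gate_edges\<close>, so
        \<open>u\<close> must not be a literal; a literal has no incoming edges and hence no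
        occurrences below it.\<close>
      have "\<exists>k. u = Gate k"
      proof (cases "u = Gate h")
        case False
        then obtain z where "(z, u) \<in> gate_edges C"
          using u(2) by (auto simp: occurrences_def elim: rtranclE)
        then show ?thesis
          using no_edge_to_Lit by (cases u) (auto simp: gate_edges_def)
      qed simp
      then have "(u, Gate g) \<in> gate_edges C"
        using u(1) by (simp add: gate_edges_def)
      then show ?thesis
        using u(2) by (auto simp: occurrences_def intro: rtrancl_into_rtrancl)
    qed
  qed
  also have "\<dots> \<le> weight C (Gate g) x"
    by (simp add: weight_def)
  finally show ?thesis by (simp add: D_def)
qed

lemma weight_input_le:
  assumes "(u, Gate g) \<in> edges C"
  shows "weight C u x \<le> weight C (Gate g) x"
proof -
  have "weight C u x \<le> (\<Sum>u\<in>{u. (u, Gate g) \<in> edges C}. weight C u x)"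
    using assms finite_inputs by (intro member_le_sum) auto
  then show ?thesis using sum_weight_le[where g = g and x = x] by simp
qed

text \<open>Positive weight at an input passes to the gate by \<open>weight_input_le\<close>; at a
  literal, the \<open>of_bool\<close> summand makes the weight positive.\<close>

lemma val_cong:
  assumes "v \<in> verts C" "\<And>x. weight C v x > 0 \<Longrightarrow> x \<in> S \<longleftrightarrow> x \<in> T"
  shows "val C v S = val C v T"
  using wf_edges assms
proof (induction v rule: wf_induct_rule)
  case (less v)
  have IH: "val C u S = val C u T" if uv: "(u, v) \<in> edges C" for u
  proof (rule less.IH[OF uv])
    show "u \<in> verts C" using uv edge_verts by blast
    fix x
    assume "weight C u x > 0"
    moreover obtain g where "v = Gate g"
      using uv no_edge_to_Lit[of u] by (cases v) auto
    ultimately show "x \<in> S \<longleftrightarrow> x \<in> T"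
      using uv weight_input_le[of u g x] less.prems(2)[of x] by simp
  qed
  from less.prems(1) show ?case
  proof (cases rule: vertex_cases)
    case (Lit x)
    then show ?thesis using less.prems(2)[of x] by (simp add: vertex_true_Lit weight_def)
  next
    case AND
    then show ?thesis using IH by (auto simp: vertex_true_AND)
  next
    case OR
    then show ?thesis using IH by (auto simp: vertex_true_OR)
  qed
qed

section \<open>Path lengths and the induction on height\<close>

lemma path_from_Lit:
  assumes "v \<in> verts C"
  shows "\<exists>l k. (Lit l, v) \<in> edges C ^^ k"
  using wf_edges assms
proof (induction v rule: wf_induct_rule)
  case (less v)
  show ?case
  proof (cases v)
    case (Lit l)
    then show ?thesis by (meson relpow_0_I)
  next
    case (Gate g)
    then obtain u where u: "(u, v) \<in> edges C"
      using less.prems gate_has_input by blast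
    then show ?thesis
      using less.IH edge_verts by (meson relpow_Suc_I)
  qed
qed

text \<open>Makes the \<open>Max\<close> in \<open>depth\<close> a genuine maximum. Every nontrivial
  path extends one into some input, and there are finitely many inputs.\<close>

lemma finite_path_lengths: "finite {k. \<exists>l. (Lit l, v) \<in> edges C ^^ k}"
  using wf_edges
proof (induction v rule: wf_induct_rule)
  case (less v)
  have "{k. \<exists>l. (Lit l, v) \<in> edges C ^^ k} \<subseteq>
      insert 0 (\<Union>u\<in>{u. (u, v) \<in> edges C}. Suc ` {k. \<exists>l. (Lit l, u) \<in> edges C ^^ k})"
  proof
    fix k
    assume "k \<in> {k. \<exists>l. (Lit l, v) \<in> edges C ^^ k}"
    then obtain l where l: "(Lit l, v) \<in> edges C ^^ k" by blast
    show "k \<in> insert 0 (\<Union>u\<in>{u. (u, v) \<in> edges C}. Suc ` {k. \<exists>l. (Lit l, u) \<in> edges C ^^ k})"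
    proof (cases k)
      case (Suc k')
      then show ?thesis using l by (auto elim!: relpow_Suc_E)
    qed simp
  qed
  moreover have "finite (insert 0 (\<Union>u\<in>{u. (u, v) \<in> edges C}.
      Suc ` {k. \<exists>l. (Lit l, u) \<in> edges C ^^ k}))"
    using less finite_inputs by auto
  ultimately show ?case by (rule finite_subset)
qed

lemma path_length_le_depth: "(Lit l, Gate (out_gate C)) \<in> edges C ^^ k \<Longrightarrow> k \<le> depth C"
  unfolding depth_def by (rule Max_ge[OF finite_path_lengths]) blast

text \<open>The exponent solves the recurrence that replaces \<open>e\<close> by
  \<open>(2 * e) ^ K\<close> at each level, the cost of an AND-gate, which also covers an
  OR-gate.\<close>

lemma large_sat_val:
  assumes "v \<in> verts C" "0 < K" "\<And>l k. (Lit l, v) \<in> edges C ^^ k \<Longrightarrow> k \<le> h"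
  shows "large_sat K (2 ^ (2 * K) ^ h) (val C v) (weight C v)"
  using assms
proof (induction h arbitrary: v)
  case (0 v)
  have Lit: "\<exists>x. v = Lit (Neg x)"
    using path_from_Lit[OF 0(1)] 0(1,3) anti by (fastforce simp: antimonotone_def)
  show ?case
    unfolding large_sat_def
  proof (intro allI impI, elim conjE)
    fix s and X :: "'x set"
    assume X: "K < s" "\<forall>x\<in>X. weight C v x \<le> K \<and> val C v {x}" "s ^ 2 ^ (2 * K) ^ 0 \<le> card X"
    \<comment> \<open>For a literal \<open>Neg x\<close>, no variable of \<open>X\<close> is
      \<open>x\<close>, so the whole of \<open>X\<close> serves.\<close>
    have "s \<le> s ^ 2 ^ (2 * K) ^ 0" by (simp add: power2_eq_square)
    then show "\<exists>Y\<subseteq>X. s \<le> card Y \<and> val C v Y"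
      using X Lit by (intro exI[of _ X]) (auto simp: vertex_true_Lit)
  qed
next
  case (Suc h v)
  define e :: nat where "e = 2 ^ (2 * K) ^ h"
  define D where "D = {u. (u, v) \<in> edges C}"
  have finD: "finite D" by (simp add: D_def finite_inputs)
  have DV: "u \<in> verts C" if "u \<in> D" for u
    using that edge_verts by (auto simp: D_def)
  have anti: "val C u S" if "u \<in> D" "S \<subseteq> T" "val C u T" for u S T
    using that DV val_antitone by blast
  have cong: "val C u S = val C u T"
    if "u \<in> D" "\<And>x. weight C u x > 0 \<Longrightarrow> x \<in> S \<longleftrightarrow> x \<in> T" for u S T
    using that(1) by (intro val_cong DV that(2))
  have empty: "val C u {}" if "u \<in> D" for u
    using that DV val_empty by blast
  have ls: "large_sat K e (val C u) (weight C u)" if "u \<in> D" for u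
    unfolding e_def
  proof (rule Suc.IH[OF DV[OF that] Suc.prems(2)])
    fix l k
    assume "(Lit l, u) \<in> edges C ^^ k"
    then have "(Lit l, v) \<in> edges C ^^ Suc k"
      using that by (auto simp: D_def intro: relpow_Suc_I)
    then show "k \<le> h" using Suc.prems(3) by fastforce
  qed
  have pos: "1 \<le> (2 * K) ^ h" using \<open>0 < K\<close> by (simp add: Suc_le_eq)
  have e2: "2 \<le> e"
    unfolding e_def using power_increasing[OF pos, of "2::nat"] by simp
  \<comment> \<open>With \<open>p = (2 * K) ^ h\<close>, the new binary exponent
    \<open>(p + 1) * K\<close> is at most \<open>2 * p * K\<close>, since
    \<open>1 \<le> p\<close>.\<close>
  have e_Suc: "(2 * e) ^ K \<le> 2 ^ (2 * K) ^ Suc h"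
  proof -
    have "(2 * e) ^ K = (2 ^ Suc ((2 * K) ^ h)) ^ K"
      by (simp add: e_def)
    also have "\<dots> = 2 ^ (Suc ((2 * K) ^ h) * K)"
      by (rule power_mult[symmetric])
    also have "Suc ((2 * K) ^ h) * K \<le> (2 * (2 * K) ^ h) * K"
      using pos by (intro mult_right_mono) auto
    then have "(2::nat) ^ (Suc ((2 * K) ^ h) * K) \<le> 2 ^ (2 * K) ^ Suc h"
      by (intro power_increasing) (auto simp: algebra_simps)
    finally show ?thesis .
  qed
  from Suc.prems(1) show ?case
  proof (cases rule: vertex_cases)
    case (Lit x)
    \<comment> \<open>Literals can sit at any level; only the path of length 0 ends in one, so the
      induction hypothesis applies to \<open>v\<close> itself.\<close>
    have "k \<le> h" if "(Lit l, v) \<in> edges C ^^ k" for l k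
      using that Lit no_edge_to_Lit by (cases k) (auto elim!: relpow_Suc_E)
    then have "large_sat K e (val C v) (weight C v)"
      unfolding e_def by (rule Suc.IH[OF Suc.prems(1,2)])
    moreover have "e \<le> (2 * e) ^ K"
      using \<open>0 < K\<close> power_increasing[of 1 K "2 * e"] e2 by simp
    ultimately show ?thesis using e_Suc large_sat_mono by (metis le_trans)
  next
    case (AND g)
    have "large_sat K ((2 * e) ^ K) (\<lambda>S. \<forall>u\<in>D. val C u S) (weight C v)"
      using AND sum_weight_le
      by (intro large_sat_conj[OF finD anti cong empty ls e2]) (simp_all add: D_def)
    moreover have "(\<lambda>S. \<forall>u\<in>D. val C u S) = val C v"
      using AND by (auto simp: fun_eq_iff D_def vertex_true_AND)
    ultimately show ?thesis using e_Suc large_sat_mono by metis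
  next
    case (OR g)
    have "large_sat K (Suc e) (\<lambda>S. \<exists>u\<in>D. val C u S) (weight C v)"
      using OR sum_weight_le
      by (intro large_sat_disj[OF finD cong empty ls]) (simp_all add: D_def)
    moreover have "(\<lambda>S. \<exists>u\<in>D. val C u S) = val C v"
      using OR by (auto simp: fun_eq_iff D_def vertex_true_OR)
    moreover have "Suc e \<le> (2 * e) ^ K"
      using e2 \<open>0 < K\<close> power_increasing[of 1 K "2 * e"] by simp
    ultimately show ?thesis using e_Suc large_sat_mono by (metis le_trans)
  qed
qed

section \<open>Non-zero-variables and averaging\<close>

lemma finite_variables: "finite (variables C)"
proof -
  have "finite (verts C)" using circuit by (simp add: boolean_circuit_def)
  then have "finite ((\<lambda>v. case v of Lit l \<Rightarrow> var_of l) ` verts C)"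
    by simp
  then show ?thesis
    by (rule rev_finite_subset) (force simp: variables_def)
qed

lemma variables_nonempty: "variables C \<noteq> {}"
proof -
  have out: "Gate (out_gate C) \<in> verts C"
    using circuit by (simp add: boolean_circuit_def)
  obtain l k where "(Lit l, Gate (out_gate C)) \<in> edges C ^^ k"
    using path_from_Lit[OF out] by blast
  then obtain u where "(Lit l, u) \<in> edges C"
    by (cases k) (auto simp del: relpow.simps(2) dest!: relpow_Suc_D2)
  then show ?thesis
    using edge_verts by (auto simp: variables_def)
qed

text \<open>By antitonicity, a satisfying assignment with \<open>x\<close> set to 1 stays satisfying
  when all other variables are set to 0.\<close>

lemma satisfies_singleton:
  assumes "x \<in> variables C" "\<not> zero_variable C x"
  shows "val C (Gate (out_gate C)) {x}"
proof -
  obtain a where a: "a x" "satisfies a C"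
    using assms by (auto simp: zero_variable_def)
  then have "val C (Gate (out_gate C)) {y. a y}"
    by (simp add: satisfies_def)
  moreover have "Gate (out_gate C) \<in> verts C"
    using circuit by (simp add: boolean_circuit_def)
  ultimately show ?thesis
    using val_antitone a(1) by (metis empty_subsetI insert_subset mem_Collect_eq)
qed

text \<open>Pairs of a variable and a gate it feeds inject into the literal edges; the output is a
  gate, so its \<open>of_bool\<close> summand vanishes.\<close>

lemma sum_weight_out_le:
  assumes "finite A"
  shows "(\<Sum>x\<in>A. weight C (Gate (out_gate C)) x) \<le> num_occurrences C"
proof -
  let ?O = "occurrences C (Gate (out_gate C))"
  have "finite {(l, g). (Lit l, Gate g) \<in> edges C}"
    by (rule finite_subset[OF _ finite_imageI[OF finite_edges,
      of "\<lambda>(u, v). (case u of Lit l \<Rightarrow> l, case v of Gate g \<Rightarrow> g)"]]) force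
  moreover have "inj_on (\<lambda>(x, g). (Neg x, g)) (Sigma A ?O)"
    by (auto simp: inj_on_def)
  moreover have "(\<lambda>(x, g). (Neg x, g)) ` Sigma A ?O \<subseteq> {(l, g). (Lit l, Gate g) \<in> edges C}"
    by (auto simp: occurrences_def)
  ultimately have "card (Sigma A ?O) \<le> num_occurrences C"
    unfolding num_occurrences_def by (metis (no_types, lifting) card_inj_on_le)
  then show ?thesis
    using assms finite_occurrences by (simp add: weight_def)
qed

text \<open>Markov's inequality: each variable in \<open>B\<close> has at least \<open>Suc K\<close>
  occurrences, and \<open>2 * c \<le> K\<close>.\<close>

lemma half_of_variables_rare:
  assumes "real (num_occurrences C) \<le> c * real (card (variables C))" "2 * c \<le> real K"
  shows "card (variables C) \<le> 2 * card {x \<in> variables C. weight C (Gate (out_gate C)) x \<le> K}"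
proof -
  let ?w = "weight C (Gate (out_gate C))"
  define A where "A = {x \<in> variables C. ?w x \<le> K}"
  define B where "B = {x \<in> variables C. K < ?w x}"
  have fin: "finite A" "finite B" using finite_variables by (auto simp: A_def B_def)
  have "variables C = A \<union> B" "A \<inter> B = {}" by (auto simp: A_def B_def)
  then have n: "card (variables C) = card A + card B"
    using fin by (simp add: card_Un_disjoint)
  have "card B * Suc K = (\<Sum>x\<in>B. Suc K)" by simp
  also have "\<dots> \<le> (\<Sum>x\<in>B. ?w x)"
    by (intro sum_mono) (auto simp: B_def)
  also have "\<dots> \<le> num_occurrences C"
    using fin(2) by (rule sum_weight_out_le)
  finally have "real (card B * Suc K) \<le> c * real (card (variables C))"
    using assms(1) by linarith
  then have "2 * (real (card B) * real (Suc K)) \<le> (2 * c) * real (card (variables C))"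
    by (simp only: of_nat_mult mult.assoc)
  also have "\<dots> \<le> real (Suc K) * real (card (variables C))"
    using assms(2) by (intro mult_right_mono) auto
  finally have "2 * real (card B) \<le> real (card (variables C))"
    using mult_le_cancel_left_pos[of "real (Suc K)" "2 * real (card B)" "real (card (variables C))"]
    by (simp add: mult.left_commute mult.commute)
  then show ?thesis using n unfolding A_def[symmetric] by linarith
qed

end

section \<open>Iterated logarithms\<close>

text \<open>Lets a single power \<open>d ^ t\<close> dominate both the exponent of the height
  induction and an additive slack.\<close>

lemma power_add_le_add_power:
  fixes a b :: nat
  assumes "0 < t"
  shows "a ^ t + b ^ t \<le> (a + b) ^ t"
  using assms
proof (induction t rule: nat_induct_non_zero)
  case (Suc t)
  have "a ^ Suc t + b ^ Suc t \<le> (a + b) * (a ^ t + b ^ t)"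
    by (simp add: algebra_simps)
  also have "\<dots> \<le> (a + b) * (a + b) ^ t"
    using Suc.IH by (rule mult_left_mono) simp
  finally show ?case by simp
qed simp

text \<open>The tangent bound for the exponential at \<open>x - 1\<close>, with
  \<open>ln 2 \<ge> 1 / 2\<close>, then doubled.\<close>

lemma add_one_le_two_powr:
  fixes x :: real
  assumes "1 \<le> x"
  shows "x + 1 \<le> 2 powr x"
proof -
  have "exp (1 / 2 :: real) ^ 2 \<le> 2 ^ 2"
    using exp_le by (simp add: power2_eq_square flip: exp_add)
  then have "exp (1 / 2 :: real) \<le> 2"
    by (rule power2_le_imp_le) simp
  then have ln2: "1 / 2 \<le> ln (2::real)"
    by (subst ln_ge_iff) auto
  have "1 + (x - 1) / 2 \<le> 1 + (x - 1) * ln 2"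
    using mult_left_mono[OF ln2, of "x - 1"] assms by simp
  also have "\<dots> \<le> exp ((x - 1) * ln 2)"
    by (rule exp_ge_add_one_self)
  also have "\<dots> = 2 powr (x - 1)"
    by (simp add: powr_def)
  also have "\<dots> = 2 powr x / 2"
    by (simp add: powr_diff)
  finally show ?thesis by (simp add: field_simps)
qed

lemma iter_log2_Suc: "iter_log2 (Suc i) x = iter_log2 i (if x > 0 then log 2 x else 0)"
  by (simp add: iter_log2_def funpow_Suc_right del: funpow.simps)

lemma iter_log2_zero: "iter_log2 i 0 = 0"
  by (induction i) (simp_all add: iter_log2_def)

text \<open>The default value 0 persists under iteration, so a result above 1 certifies a genuine,
  invertible logarithm at the first step.\<close>

lemma iter_log2_gt_one:
  assumes "1 < iter_log2 (Suc i) x"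
  shows "iter_log2 (Suc i) x = iter_log2 i (log 2 x)" "x = 2 powr log 2 x"
proof -
  have "x > 0"
    using assms by (auto simp: iter_log2_Suc iter_log2_zero split: if_splits)
  then show "iter_log2 (Suc i) x = iter_log2 i (log 2 x)" "x = 2 powr log 2 x"
    by (simp_all add: iter_log2_Suc)
qed

text \<open>Undoing one logarithm raises a value of at least 1 by at least 1.\<close>

lemma iter_log2_add_le:
  assumes "1 < iter_log2 i x"
  shows "iter_log2 i x + real i \<le> x"
  using assms
proof (induction i arbitrary: x)
  case 0
  then show ?case by (simp add: iter_log2_def)
next
  case (Suc i)
  note eqs = iter_log2_gt_one[OF Suc.prems]
  have IH: "iter_log2 i (log 2 x) + real i \<le> log 2 x"
    using Suc eqs(1) by simp
  then have "log 2 x + 1 \<le> 2 powr log 2 x"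
    using Suc.prems eqs(1) by (intro add_one_le_two_powr) simp
  then show ?case using IH eqs by simp
qed

text \<open>The left side is at most 2 to the power \<open>1 + w * 2 ^ m\<close>, and this exponent
  is at most \<open>2 powr (2 * w)\<close>, hence at most \<open>2 powr (2 powr w)\<close>.\<close>

lemma power_le_triple_exponential:
  fixes w :: real
  assumes "2 \<le> w" "real s \<le> w" "real m \<le> w"
  shows "2 * real s ^ (2 ^ m) \<le> 2 powr (2 powr (2 powr w))"
proof -
  have w: "1 + w \<le> 2 powr w"
    using add_one_le_two_powr[of w] assms(1) by simp
  have "2 ^ m = 2 powr real m" by (simp add: powr_realpow)
  also have "\<dots> \<le> 2 powr w" using assms(3) by simp
  finally have m: "(2::real) ^ m \<le> 2 powr w" .
  have "2 * w \<le> 2 * 2 powr (w - 1)"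
    using add_one_le_two_powr[of "w - 1"] assms(1) by simp
  then have w2: "2 * w \<le> 2 powr w"
    by (simp add: powr_diff)
  have "1 + w * 2 ^ m \<le> 2 ^ m * (1 + w)"
    by (simp add: algebra_simps)
  also have "\<dots> \<le> 2 powr w * 2 powr w"
    using m w assms(1) by (intro mult_mono) auto
  also have "\<dots> = 2 powr (2 * w)"
    by (simp flip: powr_add)
  also have "\<dots> \<le> 2 powr (2 powr w)"
    using w2 by simp
  finally have exp: "1 + w * 2 ^ m \<le> 2 powr (2 powr w)" .
  have "real s ^ (2 ^ m) \<le> (2 powr w) ^ (2 ^ m)"
    using assms(2) w by (intro power_mono) auto
  also have "\<dots> = 2 powr (w * 2 ^ m)"
    by (simp add: powr_powr flip: powr_realpow)
  finally have "2 * real s ^ (2 ^ m) \<le> 2 powr (1 + w * 2 ^ m)"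
    by (simp add: powr_add)
  also have "\<dots> \<le> 2 powr (2 powr (2 powr w))"
    using exp by simp
  finally show ?thesis .
qed

lemma power_le_of_iter_log2:
  assumes "1 < iter_log2 (i + 3) x" "real s \<le> iter_log2 (i + 3) x + real i" "m \<le> i" "0 < i"
  shows "2 * real s ^ (2 ^ m) \<le> x"
proof -
  define w where "w = log 2 (log 2 (log 2 x))"
  have *: "1 < iter_log2 (Suc (Suc (Suc i))) x"
    using assms(1) by (simp add: numeral_3_eq_3)
  note eq1 = iter_log2_gt_one[OF *]
  note eq2 = iter_log2_gt_one[OF *[unfolded eq1(1)]]
  note eq3 = iter_log2_gt_one[OF *[unfolded eq1(1) eq2(1)]]
  have v: "iter_log2 (i + 3) x = iter_log2 i w"
    using eq1(1) eq2(1) eq3(1) by (simp add: numeral_3_eq_3 w_def)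
  have x: "x = 2 powr (2 powr (2 powr w))"
    using eq1(2) eq2(2) eq3(2) by (simp add: w_def)
  \<comment> \<open>Three logarithms supply the tower; the other \<open>i\<close> push
    \<open>w\<close> above \<open>s\<close>, \<open>m\<close> and 2.\<close>
  have "iter_log2 i w + real i \<le> w"
    using assms(1) v by (intro iter_log2_add_le) simp
  then show ?thesis
    unfolding x using assms v by (intro power_le_triple_exponential) auto
qed

section \<open>Choice of the constants and conclusion\<close>

theorem theorem2:
  fixes c :: real
  shows "\<exists>d::nat. d > 0 \<and>
    (\<forall>(t::nat) (n::nat) (C :: (nat, nat) circuit).
       t \<ge> 2 \<and> Pi_circuit t C \<and> antimonotone C \<and> card (variables C) = n \<and>
       (\<nexists>x. zero_variable C x) \<and> real (num_occurrences C) \<le> c * real n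
       \<longrightarrow> (\<exists>a. satisfies a C \<and>
              real (card {x \<in> variables C. a x}) \<ge> iter_log2 (d ^ t) (real n)))"
proof -
  define K where "K = Suc (nat \<lceil>2 * c\<rceil>)"
  have K: "0 < K" "2 * c \<le> real K"
    unfolding K_def by (simp, linarith)
  \<comment> \<open>\<open>2 * K\<close> covers \<open>m\<close>; \<open>K + 5\<close> provides 3
    logarithms for the tower and \<open>K + 2\<close> for the excess of \<open>s\<close> over
    \<open>?v\<close>.\<close>
  define d where "d = 2 * K + (K + 5)"
  have "\<exists>a. satisfies a C \<and> real (card {x \<in> variables C. a x}) \<ge> iter_log2 (d ^ t) (real n)"
    if C: "t \<ge> 2" "Pi_circuit t C" "antimonotone C" "card (variables C) = n"
      "\<nexists>x. zero_variable C x" "real (num_occurrences C) \<le> c * real n"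
    for t n and C :: "(nat, nat) circuit"
  proof -
    interpret antimonotone_circuit C
      using C(2,3) by unfold_locales (auto simp: Pi_circuit_def)
    let ?out = "Gate (out_gate C)"
    let ?v = "iter_log2 (d ^ t) (real n)"
    have out: "?out \<in> verts C"
      using circuit by (simp add: boolean_circuit_def)
    have nonzero: "val C ?out {x}" if "x \<in> variables C" for x
      using satisfies_singleton that C(5) by blast
    have "\<exists>Y\<subseteq>variables C. ?v \<le> real (card Y) \<and> val C ?out Y"
    proof (cases "?v \<le> 1")
      \<comment> \<open>One variable suffices; this includes the case where the iterated logarithm
        defaults to 0.\<close>
      case True
      obtain x where "x \<in> variables C" using variables_nonempty by blast
      then show ?thesis using True nonzero by (intro exI[of _ "{x}"]) auto
    next
      case False
      define m where "m = (2 * K) ^ t"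
      define i where "i = d ^ t - 3"
      \<comment> \<open>Above \<open>K\<close>, as \<open>large_sat\<close> demands, and at least
        \<open>?v\<close>.\<close>
      define s where "s = K + 1 + nat \<lceil>?v\<rceil>"
      define X where "X = {x \<in> variables C. weight C ?out x \<le> K}"
      have "(2 * K) ^ t + (K + 5) ^ t \<le> d ^ t"
        unfolding d_def using C(1) by (intro power_add_le_add_power) simp
      moreover have "K + 5 \<le> (K + 5) ^ t"
        using C(1) by (intro self_le_power) auto
      ultimately have i: "d ^ t = i + 3" "m + K + 2 \<le> i"
        by (auto simp: i_def m_def)
      have "real s \<le> ?v + (real K + 2)"
        using False unfolding s_def by linarith
      also have "\<dots> \<le> ?v + real i"
        using i(2) by linarith
      \<comment> \<open>The factor 2 pays for keeping only the rare variables, at least half of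
        all.\<close>
      finally have "2 * real s ^ (2 ^ m) \<le> real n"
        using False i by (intro power_le_of_iter_log2[of i]) auto
      then have "2 * s ^ (2 ^ m) \<le> n"
        by (metis of_nat_le_iff of_nat_mult of_nat_numeral of_nat_power)
      moreover have "n \<le> 2 * card X"
        unfolding X_def using half_of_variables_rare[of c K] C(4,6) K(2) by simp
      ultimately have large: "s ^ (2 ^ m) \<le> card X" by simp
      have "large_sat K (2 ^ m) (val C ?out) (weight C ?out)"
        unfolding m_def using path_length_le_depth C(2) out K(1)
        by (intro large_sat_val) (auto simp: Pi_circuit_def intro: le_trans)
      then obtain Y where "Y \<subseteq> X" "s \<le> card Y" "val C ?out Y"
        by (rule large_satD[where s = s and X = X])
          (use finite_variables nonzero large in \<open>auto simp: X_def s_def\<close>)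
      moreover have "?v \<le> real s"
        unfolding s_def by linarith
      ultimately show ?thesis
        by (intro exI[of _ Y]) (auto simp: X_def)
    qed
    then obtain Y where Y: "Y \<subseteq> variables C" "?v \<le> real (card Y)" "val C ?out Y"
      by blast
    then have "{x \<in> variables C. x \<in> Y} = Y" by blast
    then show ?thesis
      using Y by (intro exI[of _ "\<lambda>x. x \<in> Y"]) (simp add: satisfies_def)
  qed
  moreover have "0 < d" by (simp add: d_def)
  ultimately show ?thesis by blast
qed

end
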